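(* Let $H$ be a complex Hilbert space, let $K\in B(H)$ be a bounded operator and let $A$ be a not necessarily bounded self-adjoint positive operator in $H$ with domain $D(A)$ such that $AK$ is densely defined and $(AK)^*$ is hyponormal. Then \[|\langle AKx,x\rangle|\leq \|K\|\,\langle Ax,x\rangle\] for all $x\in D(A)$.
   Context: $B(H)$ denotes the bounded (everywhere defined) linear operators on $H$. The operator $AK$ has domain $D(AK)=\{x\in H: Kx\in D(A)\}$. A self-adjoint operator $A$ is positive if $\langle Ax,x\rangle\geq 0$ for all $x\in D(A)$. A densely defined operator $T$ with domain $D(T)$ is called hyponormal if $D(T)\subset D(T^* )$ and $\|T^*x\|\leq\|Tx\|$ for all $x\in D(T)$. The inequality includes the assertion that $AKx$ is defined for every $x\in D(A)$, i.e. $D(A)\subset D(AK)$. *)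

theory Defs
  imports "HOL-Analysis.Analysis" "HOL-Library.Complex_Order"
begin

text \<open>
  Complex Hilbert spaces. Completeness and the norm topology come from class \<open>banach\<close>; the inner
  product is linear in its first argument. Definiteness of the inner product is contained in
  \<open>cinner_self\<close>, and \<open>1 *\<^sub>C x = x\<close> in \<open>scaleR_scaleC\<close>.
\<close>

class complex_hilbert_space = banach +
  fixes scaleC :: "complex \<Rightarrow> 'a \<Rightarrow> 'a" (infixr "*\<^sub>C" 75)
    and cinner :: "'a \<Rightarrow> 'a \<Rightarrow> complex"
  assumes scaleC_add_right: "c *\<^sub>C (x + y) = c *\<^sub>C x + c *\<^sub>C y"
    and scaleC_add_left: "(c + d) *\<^sub>C x = c *\<^sub>C x + d *\<^sub>C x"
    and scaleC_scaleC: "c *\<^sub>C d *\<^sub>C x = (c * d) *\<^sub>C x"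
    and scaleR_scaleC: "r *\<^sub>R x = complex_of_real r *\<^sub>C x"
    and cinner_commute: "cinner x y = cnj (cinner y x)"
    and cinner_add_left: "cinner (x + y) z = cinner x z + cinner y z"
    and cinner_scaleC_left: "cinner (c *\<^sub>C x) y = c * cinner x y"
    and cinner_self: "cinner x x = complex_of_real ((norm x)\<^sup>2)"

instantiation complex :: complex_hilbert_space
begin

definition scaleC_complex :: "complex \<Rightarrow> complex \<Rightarrow> complex"
  where "scaleC_complex c x = c * x"

definition cinner_complex :: "complex \<Rightarrow> complex \<Rightarrow> complex"
  where "cinner_complex x y = x * cnj y"

instance
  by standard
    (simp_all add: scaleC_complex_def cinner_complex_def algebra_simps scaleR_conv_of_real
      complex_norm_square del: of_real_power)

end

text \<open>The norm of such an operator is the library's \<^const>\<open>onorm\<close>.\<close>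

definition bounded_clinear :: "('a::complex_hilbert_space \<Rightarrow> 'a) \<Rightarrow> bool"
  where "bounded_clinear K \<longleftrightarrow> bounded_linear K \<and> (\<forall>c x. K (c *\<^sub>C x) = c *\<^sub>C K x)"

text \<open>
  A not necessarily bounded operator \<open>A\<close> is a partial function with domain \<^term>\<open>dom A\<close> and values
  \<^term>\<open>the (A x)\<close> for \<^term>\<open>x \<in> dom A\<close>; equality of operators thus includes equality of domains.
  For an everywhere defined \<open>K\<close>, the product \<open>AK\<close> with domain \<open>{x. K x \<in> dom A}\<close> is \<^term>\<open>A \<circ> K\<close>.
\<close>

type_synonym 'a pop = "'a \<Rightarrow> 'a option"

definition linear_pop :: "'a::complex_hilbert_space pop \<Rightarrow> bool"
  where "linear_pop A \<longleftrightarrow> 0 \<in> dom A \<and>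
    (\<forall>x\<in>dom A. \<forall>y\<in>dom A. A (x + y) = Some (the (A x) + the (A y))) \<and>
    (\<forall>c. \<forall>x\<in>dom A. A (c *\<^sub>C x) = Some (c *\<^sub>C the (A x)))"

definition densely_defined :: "'a::complex_hilbert_space pop \<Rightarrow> bool"
  where "densely_defined A \<longleftrightarrow> closure (dom A) = UNIV"

text \<open>
  The vector \<open>z\<close> below is unique only if \<open>A\<close> is densely defined; the adjoint is meaningful
  only in that case.
\<close>

definition pop_adjoint :: "'a::complex_hilbert_space pop \<Rightarrow> 'a pop"
  where "pop_adjoint A y =
    (if \<exists>z. \<forall>x\<in>dom A. cinner (the (A x)) y = cinner x z
     then Some (THE z. \<forall>x\<in>dom A. cinner (the (A x)) y = cinner x z)
     else None)"

definition self_adjoint :: "'a::complex_hilbert_space pop \<Rightarrow> bool"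
  where "self_adjoint A \<longleftrightarrow> linear_pop A \<and> densely_defined A \<and> pop_adjoint A = A"

text \<open>In the order on \<^typ>\<open>complex\<close>, \<open>0 \<le> z\<close> says that \<open>z\<close> is real and nonnegative.\<close>

definition positive_pop :: "'a::complex_hilbert_space pop \<Rightarrow> bool"
  where "positive_pop A \<longleftrightarrow> (\<forall>x\<in>dom A. 0 \<le> cinner (the (A x)) x)"

definition hyponormal :: "'a::complex_hilbert_space pop \<Rightarrow> bool"
  where "hyponormal T \<longleftrightarrow> linear_pop T \<and> densely_defined T \<and> dom T \<subseteq> dom (pop_adjoint T) \<and>
    (\<forall>x\<in>dom T. norm (the (pop_adjoint T x)) \<le> norm (the (T x)))"

end

theory Submission imports Defs begin

text \<open>
  Since \<open>K\<^sup>*A \<subseteq> (AK)\<^sup>*\<close>, we have \<open>(AK)\<^sup>*\<^sup>* \<subseteq> (K\<^sup>*A)\<^sup>* = AK\<close>, so hyponormality of \<open>(AK)\<^sup>*\<close> yields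
  \<open>\<parallel>AKx\<parallel> \<le> \<parallel>K\<^sup>*Ax\<parallel> \<le> \<parallel>K\<parallel> \<parallel>Ax\<parallel>\<close> on \<open>D(A)\<close>. By a Riesz argument, every \<open>y \<in> D(A)\<close> then has a
  \<open>z \<in> D(A)\<close> with \<open>Az = K\<^sup>*Ay\<close> and \<open>\<parallel>z\<parallel> \<le> \<parallel>K\<parallel> \<parallel>y\<parallel>\<close>. Taking \<open>Ky\<close> for \<open>y\<close> and iterating \<open>y \<mapsto> z\<close>
  from \<open>x\<close>, the moments \<open>m\<^sub>k = \<langle>Ax\<^sub>k, x\<rangle>\<close> satisfy \<open>m\<^sub>k\<^sup>2 \<le> m\<^sub>2\<^sub>k m\<^sub>0\<close> and grow at most like \<open>\<parallel>K\<parallel>\<^sup>2\<^sup>k\<close>,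
  whence \<open>\<langle>AKx, Kx\<rangle> = m\<^sub>1 \<le> \<parallel>K\<parallel>\<^sup>2 \<langle>Ax, x\<rangle>\<close>. The Cauchy-Schwarz inequality for the form
  \<open>\<langle>Ax, y\<rangle>\<close> finishes the proof.
\<close>

section \<open>Complex inner products\<close>

lemma cinner_add_right: "cinner x (y + z) = cinner x y + cinner x z"
  by (metis cinner_add_left cinner_commute complex_cnj_add)

lemma cinner_scaleC_right: "cinner x (c *\<^sub>C y) = cnj c * cinner x y"
  by (metis cinner_scaleC_left cinner_commute complex_cnj_mult)

lemma uminus_scaleC: "- x = (-1) *\<^sub>C (x::'a::complex_hilbert_space)"
  using scaleR_scaleC[of "-1" x] by simp

lemma cinner_minus_left: "cinner (- x) y = - cinner x y"
  by (subst uminus_scaleC) (simp add: cinner_scaleC_left)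

lemma cinner_diff_left: "cinner (x - y) z = cinner x z - cinner y z"
  using cinner_add_left[of x "- y" z] by (simp add: cinner_minus_left)

lemma cinner_diff_right: "cinner x (y - z) = cinner x y - cinner x z"
  by (metis cinner_diff_left cinner_commute complex_cnj_diff)

lemma norm_sq_cinner: "(norm x)\<^sup>2 = Re (cinner x x)"
  by (simp add: cinner_self)

text \<open>A partial operator is modelled by a total function on a subspace \<open>V\<close>; its
  values off \<open>V\<close> are never constrained. With target type \<open>complex\<close> the
  same notion covers functionals.\<close>

definition clinear_on ::
  "'a::complex_hilbert_space set \<Rightarrow> ('a \<Rightarrow> 'b::complex_hilbert_space) \<Rightarrow> bool"
  where "clinear_on V f \<longleftrightarrow> 0 \<in> V \<and>
    (\<forall>x\<in>V. \<forall>y\<in>V. x + y \<in> V \<and> f (x + y) = f x + f y) \<and>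
    (\<forall>c. \<forall>x\<in>V. c *\<^sub>C x \<in> V \<and> f (c *\<^sub>C x) = c *\<^sub>C f x)"

text \<open>The form \<open>cinner (L x) y\<close> is positive semidefinite on \<open>V\<close>, so
  its nonnegativity along the line \<open>x + t b y\<close>, with \<open>b\<close> the form's value
  at \<open>(x, y)\<close>, gives a real quadratic in \<open>t\<close>.\<close>

lemma Cauchy_Schwarz_form:
  fixes L :: "'a::complex_hilbert_space \<Rightarrow> 'a"
  assumes lin: "clinear_on V L"
    and sym: "\<And>x y. x \<in> V \<Longrightarrow> y \<in> V \<Longrightarrow> cinner (L x) y = cinner x (L y)"
    and pos: "\<And>x. x \<in> V \<Longrightarrow> 0 \<le> Re (cinner (L x) x)"
    and x: "x \<in> V" and y: "y \<in> V"
  shows "(cmod (cinner (L x) y))\<^sup>2 \<le> Re (cinner (L x) x) * Re (cinner (L y) y)"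
proof -
  define b where "b = cinner (L x) y"
  define p where "p = Re (cinner (L x) x)"
  define d where "d = Re (cinner (L y) y)"
  define B where "B = (cmod b)\<^sup>2"
  have yx: "cinner (L y) x = cnj b"
    unfolding b_def using sym[OF x y] cinner_commute[of "L y" x] by simp
  have quad: "0 \<le> p + 2 * t * B + t\<^sup>2 * B * d" for t
  proof -
    \<comment> \<open>The factor \<open>b\<close> aligns the phases, so both cross terms become the
      real number \<open>t * B\<close>.\<close>
    define s where "s = complex_of_real t * b"
    have sy: "s *\<^sub>C y \<in> V" and V: "x + s *\<^sub>C y \<in> V"
      and L: "L (x + s *\<^sub>C y) = L x + s *\<^sub>C L y"
      using lin x y unfolding clinear_on_def by metis+
    have "cinner (L (x + s *\<^sub>C y)) (x + s *\<^sub>C y) =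
      cinner (L x) x + cnj s * b + s * cnj b + s * cnj s * cinner (L y) y"
      unfolding L by (simp add: cinner_add_left cinner_add_right cinner_scaleC_left
        cinner_scaleC_right yx b_def algebra_simps)
    also have "cnj s * b = complex_of_real (t * B)"
      by (simp add: s_def B_def complex_norm_square mult_ac del: of_real_power)
    also have "s * cnj b = complex_of_real (t * B)"
      by (simp add: s_def B_def complex_norm_square mult_ac del: of_real_power)
    also have "s * cnj s = complex_of_real (t\<^sup>2 * B)"
      by (simp add: s_def B_def complex_norm_square power_mult_distrib power2_eq_square[of t] mult_ac
        del: of_real_power)
    finally have "Re (cinner (L (x + s *\<^sub>C y)) (x + s *\<^sub>C y)) = p + 2 * t * B + t\<^sup>2 * B * d"
      by (simp add: p_def d_def)
    then show ?thesis using pos[OF V] by simp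
  qed
  have "B \<le> p * d"
  proof (cases "d = 0")
    case True
    have "B = 0"
    proof (rule ccontr)
      assume "B \<noteq> 0"
      \<comment> \<open>For \<open>d = 0\<close> the polynomial is affine in \<open>t\<close>; this
        \<open>t\<close> gives it the value \<open>-1\<close>.\<close>
      then show False
        using quad[of "- (p + 1) / (2 * B)"] True by (simp add: field_simps)
    qed
    then show ?thesis using True by simp
  next
    case False
    then have "d > 0" using pos[OF y] d_def by simp
    \<comment> \<open>The minimiser \<open>t = -1/d\<close> leaves \<open>p - B/d\<close>.\<close>
    then show ?thesis
      using quad[of "- 1 / d"] by (simp add: field_simps power2_eq_square)
  qed
  then show ?thesis by (simp add: B_def p_def d_def b_def)
qed

lemma cmod_cinner_le: "cmod (cinner x y) \<le> norm x * norm y"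
proof -
  have "(cmod (cinner x y))\<^sup>2 \<le> (norm x * norm y)\<^sup>2"
    using Cauchy_Schwarz_form[of UNIV "\<lambda>x. x" x y]
    by (simp add: clinear_on_def power_mult_distrib norm_sq_cinner[symmetric])
  then show ?thesis by (rule power2_le_imp_le) simp
qed

lemma bounded_linear_Re_cinner: "bounded_linear (\<lambda>x. Re (cinner x y))"
proof (rule bounded_linear_intro)
  show "norm (Re (cinner x y)) \<le> norm x * norm y" for x
    using abs_Re_le_cmod[of "cinner x y"] cmod_cinner_le[of x y] by simp
qed (simp_all add: cinner_add_left scaleR_scaleC cinner_scaleC_left)

text \<open>The zero set of \<open>Re (cinner x (y - z))\<close> is closed and contains a dense set,
  hence also the vector \<open>y - z\<close> itself.\<close>

lemma cinner_eq_on_dense: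
  assumes dense: "closure V = UNIV" and eq: "\<And>v. v \<in> V \<Longrightarrow> cinner v y = cinner v z"
  shows "y = z"
proof -
  have "closure V \<subseteq> {x. Re (cinner x (y - z)) = 0}"
  proof (rule closure_minimal)
    show "closed {x. Re (cinner x (y - z)) = 0}"
      by (intro closed_Collect_eq continuous_on_const
        linear_continuous_on bounded_linear_Re_cinner)
  qed (auto simp: cinner_diff_right eq)
  then have "Re (cinner (y - z) (y - z)) = 0" using dense by blast
  then show ?thesis by (simp add: norm_sq_cinner[symmetric])
qed

text \<open>
  Minimising \<open>\<parallel>Lx\<parallel>\<^sup>2 - 2 Re (f x)\<close> represents \<open>f\<close> through \<open>L\<close>; neither the domain nor the range of
  \<open>L\<close> has to be closed.
\<close>

lemma Riesz_representation_through:
  fixes L :: "'a::complex_hilbert_space \<Rightarrow> 'b::complex_hilbert_space" and f :: "'a \<Rightarrow> complex"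
  assumes L: "clinear_on V L" and f: "clinear_on V f"
    and bound: "\<And>x. x \<in> V \<Longrightarrow> cmod (f x) \<le> c * norm (L x)"
  obtains z where "\<And>x. x \<in> V \<Longrightarrow> f x = cinner (L x) z" and "norm z \<le> c \<or> z = 0"
proof -
  define J where "J x = (norm (L x))\<^sup>2 - 2 * Re (f x)" for x
  define m where "m = Inf (J ` V)"
  have V0: "0 \<in> V" and Vadd: "\<And>x y. x \<in> V \<Longrightarrow> y \<in> V \<Longrightarrow> x + y \<in> V"
    and Vsc: "\<And>c x. x \<in> V \<Longrightarrow> c *\<^sub>C x \<in> V"
    and Ladd: "\<And>x y. x \<in> V \<Longrightarrow> y \<in> V \<Longrightarrow> L (x + y) = L x + L y"
    and Lsc: "\<And>c x. x \<in> V \<Longrightarrow> L (c *\<^sub>C x) = c *\<^sub>C L x"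
    using L unfolding clinear_on_def by auto
  have fadd: "\<And>x y. x \<in> V \<Longrightarrow> y \<in> V \<Longrightarrow> f (x + y) = f x + f y"
    and fsc: "\<And>c x. x \<in> V \<Longrightarrow> f (c *\<^sub>C x) = c * f x"
    using f unfolding clinear_on_def by (auto simp: scaleC_complex_def)
  have Jlow: "- c\<^sup>2 \<le> J x" if "x \<in> V" for x
  proof -
    have "Re (f x) \<le> c * norm (L x)"
      using complex_Re_le_cmod[of "f x"] bound[OF that] by linarith
    moreover have "0 \<le> (norm (L x) - c)\<^sup>2" by simp
    ultimately show ?thesis by (simp add: J_def power2_eq_square algebra_simps)
  qed
  have bdd: "bdd_below (J ` V)" using Jlow by (auto intro!: bdd_belowI[of _ "- c\<^sup>2"])
  have mle: "m \<le> J x" if "x \<in> V" for x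
    unfolding m_def using that bdd by (auto intro: cInf_lower)
  have "\<exists>x\<in>V. J x < m + 1 / real (Suc n)" for n
    using cInf_lessD[of "J ` V" "m + 1 / real (Suc n)"] V0 unfolding m_def by auto
  then obtain X where XV: "\<And>n. X n \<in> V" and XJ: "\<And>n. J (X n) < m + 1 / real (Suc n)"
    by metis
  have J_line: "J (x + complex_of_real t *\<^sub>C v) =
      J x + 2 * t * (Re (cinner (L x) (L v)) - Re (f v)) + t\<^sup>2 * (norm (L v))\<^sup>2"
    if x: "x \<in> V" and v: "v \<in> V" for x v t
  proof -
    have "Re (cinner (L v) (L x)) = Re (cinner (L x) (L v))"
      using cinner_commute[of "L v" "L x"] by simp
    then show ?thesis
      unfolding J_def norm_sq_cinner using x v
      by (simp add: Ladd Lsc Vsc fadd fsc cinner_add_left cinner_add_right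
        cinner_scaleC_left cinner_scaleC_right power2_eq_square algebra_simps)
  qed
  \<comment> \<open>Parallelogram identity at the midpoint \<open>x + h\<close>, where
    \<open>J\<close> is at least \<open>m\<close>. It makes the images \<open>L (X n)\<close>
    Cauchy; nothing is claimed about convergence of \<open>X n\<close>.\<close>
  have par: "(norm (L x - L y))\<^sup>2 \<le> 2 * (J x - m) + 2 * (J y - m)"
    if x: "x \<in> V" and y: "y \<in> V" for x y
  proof -
    define h where "h = complex_of_real (1/2) *\<^sub>C (y + (-1) *\<^sub>C x)"
    have yx: "y + (-1) *\<^sub>C x \<in> V" using x y Vadd Vsc by blast
    have Lyx: "L (y + (-1) *\<^sub>C x) = L y - L x"
      using x y by (simp add: Ladd Lsc Vsc) (simp add: uminus_scaleC[symmetric])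
    have fyx: "f (y + (-1) *\<^sub>C x) = f y - f x"
      using x y by (simp add: fadd fsc Vsc)
    have mid: "x + h \<in> V" unfolding h_def using x yx Vadd Vsc by blast
    have "Re (cinner (L y) (L x)) = Re (cinner (L x) (L y))"
      using cinner_commute[of "L y" "L x"] by simp
    then have "4 * J (x + h) = 2 * J x + 2 * J y - (norm (L x - L y))\<^sup>2"
      unfolding h_def J_line[OF x yx] unfolding J_def norm_sq_cinner Lyx fyx
      by (simp add: cinner_diff_left cinner_diff_right power2_eq_square algebra_simps)
    then show ?thesis using mle[OF mid] by simp
  qed
  have "Cauchy (\<lambda>n. L (X n))"
  proof (rule metric_CauchyI)
    fix e :: real assume e: "0 < e"
    define d where "d = e\<^sup>2 / 4"
    have d: "0 < d" "e\<^sup>2 = 4 * d" using e by (simp_all add: d_def)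
    obtain N where N: "inverse (real (Suc N)) < d"
      using reals_Archimedean[OF d(1)] by auto
    have JN: "J (X n) - m < d" if "n \<ge> N" for n
    proof -
      have "1 / real (Suc n) \<le> inverse (real (Suc N))" using that by (simp add: field_simps)
      then show ?thesis using XJ[of n] N by linarith
    qed
    have "norm (L (X i) - L (X j)) < e" if "i \<ge> N" "j \<ge> N" for i j
    proof -
      have "(norm (L (X i) - L (X j)))\<^sup>2 < 4 * d"
        using par[OF XV XV, of i j] JN[OF that(1)] JN[OF that(2)] by argo
      then show ?thesis using e unfolding d(2)[symmetric] by (simp add: power_less_imp_less_base)
    qed
    then show "\<exists>M. \<forall>i\<ge>M. \<forall>j\<ge>M. dist (L (X i)) (L (X j)) < e"
      by (auto simp: dist_norm)
  qed
  then obtain z where z: "(\<lambda>n. L (X n)) \<longlonglongrightarrow> z"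
    using Cauchy_convergent convergent_def by blast
  have JX: "(\<lambda>n. J (X n)) \<longlonglongrightarrow> m"
  proof (rule tendsto_sandwich)
    show "\<forall>\<^sub>F n in sequentially. m \<le> J (X n)" using mle XV by simp
    show "\<forall>\<^sub>F n in sequentially. J (X n) \<le> m + inverse (real (Suc n))"
      using XJ by (simp add: less_imp_le inverse_eq_divide del: of_nat_Suc)
    show "(\<lambda>n. m + inverse (real (Suc n))) \<longlonglongrightarrow> m"
      using tendsto_add[OF tendsto_const LIMSEQ_inverse_real_of_nat, of m] by simp
  qed simp
  have Lim: "(\<lambda>n. Re (cinner (L (X n)) w)) \<longlonglongrightarrow> Re (cinner z w)" for w
    by (rule bounded_linear.tendsto[OF bounded_linear_Re_cinner z])
  \<comment> \<open>First variation. Since \<open>z\<close> is only a limit of values of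
    \<open>L\<close>, \<open>J\<close> is perturbed at \<open>X n\<close> and the limit is taken
    afterwards; \<open>r\<close> is half the derivative at \<open>t = 0\<close>.\<close>
  have real_eq: "Re (f v) = Re (cinner (L v) z)" if v: "v \<in> V" for v
  proof -
    define r where "r = Re (cinner z (L v)) - Re (f v)"
    have quad: "0 \<le> 2 * t * r + t\<^sup>2 * (norm (L v))\<^sup>2" for t
    proof -
      have "m \<le> J (X n) + 2 * t * (Re (cinner (L (X n)) (L v)) - Re (f v)) + t\<^sup>2 * (norm (L v))\<^sup>2"
        for n
        using mle[of "X n + complex_of_real t *\<^sub>C v"] J_line[OF XV v, of n t] XV v Vadd Vsc
        by metis
      moreover have "(\<lambda>n. J (X n) + 2 * t * (Re (cinner (L (X n)) (L v)) - Re (f v))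
          + t\<^sup>2 * (norm (L v))\<^sup>2) \<longlonglongrightarrow> m + 2 * t * r + t\<^sup>2 * (norm (L v))\<^sup>2"
        unfolding r_def by (intro tendsto_intros JX Lim)
      ultimately have "m \<le> m + 2 * t * r + t\<^sup>2 * (norm (L v))\<^sup>2"
        by (intro LIMSEQ_le_const) auto
      then show ?thesis by simp
    qed
    \<comment> \<open>The added 1 keeps the division valid when \<open>L v = 0\<close>; at
      \<open>t = - r / D\<close> the quadratic is at most \<open>- r^2 / D\<close>.\<close>
    define D where "D = (norm (L v))\<^sup>2 + 1"
    have D: "D > 0" "(norm (L v))\<^sup>2 \<le> D" by (simp_all add: D_def add_nonneg_pos)
    have "0 \<le> 2 * (- r / D) * r + (- r / D)\<^sup>2 * D"
      using quad[of "- r / D"] mult_left_mono[OF D(2), of "(- r / D)\<^sup>2"] by simp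
    also have "\<dots> = - (r\<^sup>2 / D)" using D(1) by (simp add: power2_eq_square)
    finally have "r\<^sup>2 / D \<le> 0" by simp
    then have "r = 0" using D(1) by (simp add: divide_le_0_iff)
    then show ?thesis unfolding r_def using cinner_commute[of z "L v"] by simp
  qed
  have eq: "f v = cinner (L v) z" if v: "v \<in> V" for v
  proof (rule complex_eqI)
    show "Re (f v) = Re (cinner (L v) z)" by (rule real_eq[OF v])
    \<comment> \<open>Multiplication by \<open>-i\<close> turns imaginary parts into real
      parts.\<close>
    have "Re (f ((- \<i>) *\<^sub>C v)) = Re (cinner (L ((- \<i>) *\<^sub>C v)) z)"
      by (rule real_eq[OF Vsc[OF v]])
    then show "Im (f v) = Im (cinner (L v) z)"
      by (simp only: fsc[OF v] Lsc[OF v] cinner_scaleC_left) simp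
  qed
  have "(\<lambda>n. norm (L (X n))) \<longlonglongrightarrow> norm z" using z by (rule tendsto_norm)
  then have "(\<lambda>n. c * norm (L (X n))) \<longlonglongrightarrow> c * norm z" by (rule tendsto_mult_left)
  moreover have "Re (cinner (L (X n)) z) \<le> c * norm (L (X n))" for n
    using complex_Re_le_cmod[of "f (X n)"] bound[OF XV, of n] eq[OF XV, of n] by simp
  ultimately have "Re (cinner z z) \<le> c * norm z"
    using Lim[of z] by (intro LIMSEQ_le) auto
  then have "norm z * norm z \<le> c * norm z"
    by (simp add: norm_sq_cinner[symmetric] power2_eq_square)
  \<comment> \<open>The alternative \<open>z = 0\<close> covers negative \<open>c\<close>, where the
    bound forces \<open>L = 0\<close> on \<open>V\<close>.\<close>
  then have "norm z \<le> c \<or> z = 0" by (cases "z = 0") auto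
  with eq show thesis by (rule that)
qed

section \<open>Adjoints\<close>

lemma pop_adjoint_eq_SomeI:
  assumes "densely_defined T" and "\<And>x. x \<in> dom T \<Longrightarrow> cinner (the (T x)) y = cinner x z"
  shows "pop_adjoint T y = Some z"
proof -
  have "(THE z. \<forall>x\<in>dom T. cinner (the (T x)) y = cinner x z) = z"
  proof (rule the_equality)
    fix w assume w: "\<forall>x\<in>dom T. cinner (the (T x)) y = cinner x w"
    show "w = z"
      by (rule cinner_eq_on_dense[of "dom T"])
        (use assms w in \<open>simp_all add: densely_defined_def\<close>)
  qed (use assms in blast)
  moreover have "\<exists>z. \<forall>x\<in>dom T. cinner (the (T x)) y = cinner x z" using assms by blast
  ultimately show ?thesis by (simp add: pop_adjoint_def)
qed

lemma pop_adjoint_cinner: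
  assumes "densely_defined T" and "y \<in> dom (pop_adjoint T)" and "x \<in> dom T"
  shows "cinner (the (T x)) y = cinner x (the (pop_adjoint T y))"
proof -
  obtain z where z: "\<forall>x\<in>dom T. cinner (the (T x)) y = cinner x z"
    using assms(2) unfolding pop_adjoint_def by (auto split: if_splits) metis
  with pop_adjoint_eq_SomeI[OF assms(1), of y z] show ?thesis using assms(3) by simp
qed

text \<open>Riesz representation through the identity map; the bound is nonnegative, so it also
  holds for \<open>z = 0\<close>.\<close>

lemma bounded_adjoint:
  assumes "bounded_clinear K"
  obtains z where "\<And>x. cinner (K x) y = cinner x z" and "norm z \<le> onorm K * norm y"
proof -
  have bl: "bounded_linear K" and sc: "\<And>c x. K (c *\<^sub>C x) = c *\<^sub>C K x"
    using assms by (auto simp: bounded_clinear_def)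
  interpret K: bounded_linear K by (rule bl)
  have bd: "cmod (cinner (K x) y) \<le> (onorm K * norm y) * norm x" for x
    using cmod_cinner_le[of "K x" y] mult_right_mono[OF onorm[OF bl, of x], of "norm y"]
    by (simp add: mult_ac)
  have nn: "0 \<le> onorm K * norm y" using onorm_pos_le[OF bl] by simp
  have lin: "clinear_on UNIV (\<lambda>x. x)" "clinear_on UNIV (\<lambda>x. cinner (K x) y)"
    by (simp_all add: clinear_on_def K.add sc cinner_add_left cinner_scaleC_left
      scaleC_complex_def)
  show thesis
  proof (rule Riesz_representation_through[OF lin bd])
    fix z assume "\<And>x. x \<in> UNIV \<Longrightarrow> cinner (K x) y = cinner x z"
      and "norm z \<le> onorm K * norm y \<or> z = 0"
    with nn show thesis by (intro that[of z]) auto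
  qed
qed

section \<open>Moments\<close>

text \<open>Repeated doubling of the index gives
  \<open>m (2^n) / m 0 \<ge> (m 1 / m 0)^(2^n)\<close>, so a ratio above \<open>b\<close> would
  outgrow \<open>C * b^k\<close>.\<close>

lemma moment_ratio_le:
  fixes m :: "nat \<Rightarrow> real"
  assumes nonneg: "\<And>k. 0 \<le> m k" and log: "\<And>k. (m k)\<^sup>2 \<le> m (2 * k) * m 0"
    and growth: "\<And>k. m k \<le> C * b ^ k" and b: "0 \<le> b"
  shows "m 1 \<le> b * m 0"
proof (cases "m 0 = 0")
  case True
  then show ?thesis using log[of 1] by simp
next
  case False
  then have m0: "m 0 > 0" using nonneg[of 0] by simp
  define r where "r = m 1 / m 0"
  have r0: "0 \<le> r" unfolding r_def using nonneg m0 by simp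
  have pow: "m 0 * r ^ (2 ^ n) \<le> m (2 ^ n)" for n
  proof (induction n)
    case 0
    then show ?case using m0 by (simp add: r_def)
  next
    case (Suc n)
    have "(m 0 * r ^ (2 ^ n))\<^sup>2 \<le> (m (2 ^ n))\<^sup>2"
      using Suc r0 m0 by (intro power_mono) auto
    also have "\<dots> \<le> m (2 ^ Suc n) * m 0" using log[of "2 ^ n"] by simp
    finally have "m 0 * (m 0 * r ^ (2 ^ Suc n)) \<le> m 0 * m (2 ^ Suc n)"
      by (simp add: power2_eq_square power_add[symmetric] mult_2 mult_ac)
    then show ?case using m0 by simp
  qed
  have "r \<le> b"
  proof (rule ccontr)
    assume "\<not> r \<le> b"
    then have rb: "b < r" by simp
    then have rpos: "0 < r" using b by linarith
    have C: "0 \<le> C" using growth[of 0] m0 by simp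
    have "(\<lambda>k. C * (b / r) ^ k) \<longlonglongrightarrow> C * 0"
      using rb rpos b by (intro tendsto_intros LIMSEQ_realpow_zero) auto
    then have "\<forall>\<^sub>F k in sequentially. C * (b / r) ^ k < m 0"
      using m0 by (simp add: order_tendsto_iff)
    then obtain N where N: "\<And>k. k \<ge> N \<Longrightarrow> C * (b / r) ^ k < m 0"
      by (auto simp: eventually_sequentially)
    have "C * (b / r) ^ (2 ^ N) < m 0" by (rule N) (simp add: less_imp_le)
    then have "C * b ^ (2 ^ N) < m 0 * r ^ (2 ^ N)"
      using rpos by (simp add: power_divide field_simps)
    then show False using pow[of N] growth[of "2 ^ N"] by linarith
  qed
  then show ?thesis using m0 by (simp add: r_def field_simps)
qed

text \<open>\<open>S\<close> is symmetric for the semi-inner product \<open>cinner (L x) y\<close>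
  but bounded only in the Hilbert norm. The moments of its iterates carry the constant
  \<open>b\<close> over to the form.\<close>

lemma symmetrizable_form_le:
  fixes L :: "'a::complex_hilbert_space \<Rightarrow> 'a"
  assumes lin: "clinear_on V L"
    and sym: "\<And>x y. x \<in> V \<Longrightarrow> y \<in> V \<Longrightarrow> cinner (L x) y = cinner x (L y)"
    and pos: "\<And>x. x \<in> V \<Longrightarrow> 0 \<le> Re (cinner (L x) x)"
    and S: "\<And>x. x \<in> V \<Longrightarrow> S x \<in> V"
    and Ssym: "\<And>x y. x \<in> V \<Longrightarrow> y \<in> V \<Longrightarrow> cinner (L (S x)) y = cinner (L x) (S y)"
    and Spos: "\<And>x. x \<in> V \<Longrightarrow> 0 \<le> Re (cinner (L (S x)) x)"
    and Snorm: "\<And>x. x \<in> V \<Longrightarrow> norm (S x) \<le> b * norm x" and b: "0 \<le> b"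
    and x: "x \<in> V"
  shows "Re (cinner (L (S x)) x) \<le> b * Re (cinner (L x) x)"
proof -
  define X where "X k = (S ^^ k) x" for k
  define m where "m k = Re (cinner (L (X k)) x)" for k
  have X0: "X 0 = x" and XS: "X (Suc k) = S (X k)" for k by (simp_all add: X_def)
  have XV: "X k \<in> V" for k by (induction k) (simp_all add: X0 XS x S)
  have shift: "cinner (L (X (k + j))) (X l) = cinner (L (X k)) (X (j + l))" for k j l
  proof (induction j arbitrary: l)
    case (Suc j)
    have "cinner (L (X (k + Suc j))) (X l) = cinner (L (X (k + j))) (X (Suc l))"
      using Ssym[OF XV XV] by (simp add: XS)
    then show ?case using Suc[of "Suc l"] by simp
  qed simp
  have even_m: "m (2 * k) = Re (cinner (L (X k)) (X k))" for k
    using shift[of k k 0] by (simp add: m_def X0 mult_2)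
  have odd_m: "m (Suc (2 * k)) = Re (cinner (L (S (X k))) (X k))" for k
    using shift[of "Suc k" k 0] by (simp add: m_def X0 XS mult_2)
  \<comment> \<open>Shifting half of the iterates to the right makes even moments values of the form
    of \<open>L\<close>, and odd moments values of the form of \<open>L S\<close>.\<close>
  have nonneg: "0 \<le> m k" for k
  proof (cases "even k")
    case True
    then show ?thesis using even_m pos[OF XV] by (auto elim!: evenE)
  next
    case False
    then show ?thesis using odd_m Spos[OF XV] by (auto elim!: oddE)
  qed
  have log: "(m k)\<^sup>2 \<le> m (2 * k) * m 0" for k
  proof -
    have "(m k)\<^sup>2 \<le> (cmod (cinner (L (X k)) x))\<^sup>2"
      unfolding m_def by (metis abs_Re_le_cmod abs_ge_zero power2_abs power_mono)
    also have "\<dots> \<le> Re (cinner (L (X k)) (X k)) * Re (cinner (L x) x)"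
      by (rule Cauchy_Schwarz_form[OF lin sym pos XV x])
    finally show ?thesis by (simp add: even_m) (simp add: m_def X0)
  qed
  have Xnorm: "norm (X k) \<le> b ^ k * norm x" for k
  proof (induction k)
    case (Suc k)
    show ?case using Snorm[OF XV, of k] mult_left_mono[OF Suc b] by (simp add: XS mult_ac)
  qed (simp add: X0)
  \<comment> \<open>Moving \<open>L\<close> onto the fixed vector \<open>x\<close> leaves only the
    Hilbert norm of \<open>X k\<close> to estimate.\<close>
  have growth: "m k \<le> (norm x * norm (L x)) * b ^ k" for k
  proof -
    have "m k \<le> cmod (cinner (X k) (L x))"
      unfolding m_def sym[OF XV x] by (rule complex_Re_le_cmod)
    also have "\<dots> \<le> norm (X k) * norm (L x)" by (rule cmod_cinner_le)
    also have "\<dots> \<le> (b ^ k * norm x) * norm (L x)" by (intro mult_right_mono Xnorm) simp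
    finally show ?thesis by (simp add: mult_ac)
  qed
  have "m 1 \<le> b * m 0" by (rule moment_ratio_le[OF nonneg log growth b])
  then show ?thesis by (simp add: m_def X_def)
qed

section \<open>From hyponormality of \<open>(AK)*\<close> to the form inequality\<close>

theorem theorem3p3:
  fixes A :: "'a::complex_hilbert_space pop" and K :: "'a \<Rightarrow> 'a"
  assumes "bounded_clinear K"
    and "self_adjoint A" and "positive_pop A"
    and "densely_defined (A \<circ> K)"
    and "hyponormal (pop_adjoint (A \<circ> K))"
  shows "\<forall>x\<in>dom A. x \<in> dom (A \<circ> K) \<and>
    complex_of_real (cmod (cinner (the ((A \<circ> K) x)) x)) \<le> complex_of_real (onorm K) * cinner (the (A x)) x"
proof -
  define L where "L x = the (A x)" for x
  define T where "T = A \<circ> K"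
  have Tdom: "x \<in> dom T \<longleftrightarrow> K x \<in> dom A" and Tval: "the (T x) = L (K x)" for x
    by (auto simp: T_def L_def)
  have bl: "bounded_linear K" and Ksc: "\<And>c x. K (c *\<^sub>C x) = c *\<^sub>C K x"
    using assms(1) by (auto simp: bounded_clinear_def)
  interpret K: bounded_linear K by (rule bl)
  have Kpos: "0 \<le> onorm K" by (rule onorm_pos_le[OF bl])
  have dA: "densely_defined A" and adjA: "pop_adjoint A = A" and linA: "linear_pop A"
    using assms(2) by (auto simp: self_adjoint_def)
  have lin: "clinear_on (dom A) L"
    unfolding clinear_on_def
  proof (intro conjI ballI allI)
    show "0 \<in> dom A" using linA by (simp add: linear_pop_def)
  next
    fix x y assume "x \<in> dom A" "y \<in> dom A"
    then have "A (x + y) = Some (L x + L y)" using linA by (simp add: linear_pop_def L_def)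
    then show "x + y \<in> dom A" "L (x + y) = L x + L y" by (auto simp: L_def)
  next
    fix c x assume "x \<in> dom A"
    then have "A (c *\<^sub>C x) = Some (c *\<^sub>C L x)" using linA by (simp add: linear_pop_def L_def)
    then show "c *\<^sub>C x \<in> dom A" "L (c *\<^sub>C x) = c *\<^sub>C L x" by (auto simp: L_def)
  qed
  have sym: "cinner (L x) y = cinner x (L y)" if "x \<in> dom A" "y \<in> dom A" for x y
    using pop_adjoint_cinner[OF dA, of y x] that by (simp add: adjA L_def)
  have posc: "0 \<le> cinner (L x) x" if "x \<in> dom A" for x
    using assms(3) that by (simp add: positive_pop_def L_def)
  then have pos: "0 \<le> Re (cinner (L x) x)" if "x \<in> dom A" for x
    using that by (simp add: less_eq_complex_def)
  \<comment> \<open>Here \<open>A* \<subseteq> A\<close> is used: a weak identity tested on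
    \<open>dom A\<close> yields membership in \<open>dom A\<close>. All later domain claims that are
    not formal rest on this.\<close>
  have A_memI: "y \<in> dom A \<and> L y = z" if "\<And>x. x \<in> dom A \<Longrightarrow> cinner (L x) y = cinner x z" for y z
    using pop_adjoint_eq_SomeI[OF dA, of y z] that by (auto simp: adjA L_def)
  have "\<exists>z. (\<forall>x. cinner (K x) y = cinner x z) \<and> norm z \<le> onorm K * norm y" for y
    by (rule bounded_adjoint[OF assms(1), of y]) blast
  then obtain Ks where Ks: "\<And>x y. cinner (K x) y = cinner x (Ks y)"
    "\<And>y. norm (Ks y) \<le> onorm K * norm y"
    by metis
  have dT: "densely_defined T" and hT: "hyponormal (pop_adjoint T)"
    using assms(4,5) by (simp_all add: T_def)
  have Tadj: "pop_adjoint T y = Some (Ks (L y))" if "y \<in> dom A" for y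
    by (rule pop_adjoint_eq_SomeI[OF dT]) (use that in \<open>simp add: Tdom Tval sym Ks(1)[symmetric]\<close>)
  have dT': "densely_defined (pop_adjoint T)" using hT by (simp add: hyponormal_def)
  \<comment> \<open>Hyponormality places \<open>x\<close> in the domain of \<open>(AK)**\<close>.
    Testing its value \<open>w\<close> there against \<open>(AK)* y = K* A y\<close> gives
    \<open>A K x = w\<close>, hence also \<open>dom A \<subseteq> dom T\<close>.\<close>
  have dom_bound: "K x \<in> dom A \<and> norm (L (K x)) \<le> onorm K * norm (L x)" if x: "x \<in> dom A" for x
  proof -
    define w where "w = the (pop_adjoint (pop_adjoint T) x)"
    have xT: "x \<in> dom (pop_adjoint T)" using Tadj[OF x] by auto
    then have xTT: "x \<in> dom (pop_adjoint (pop_adjoint T))"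
      and nw: "norm w \<le> norm (Ks (L x))"
      using hT Tadj[OF x] unfolding hyponormal_def w_def by (blast, metis option.sel)
    have "K x \<in> dom A \<and> L (K x) = w"
    proof (rule A_memI)
      fix y assume y: "y \<in> dom A"
      have "y \<in> dom (pop_adjoint T)" using Tadj[OF y] by auto
      from pop_adjoint_cinner[OF dT' xTT this]
      have "cinner (Ks (L y)) x = cinner y w" by (simp add: Tadj[OF y] w_def)
      moreover have "cinner (L y) (K x) = cinner (Ks (L y)) x"
        using Ks(1)[of _ "L y"] cinner_commute by metis
      ultimately show "cinner (L y) (K x) = cinner y w" by simp
    qed
    then show ?thesis using nw Ks(2)[of "L x"] by auto
  qed
  have step: "\<exists>z. z \<in> dom A \<and> L z = Ks (L y) \<and> norm z \<le> onorm K * norm y" if y: "y \<in> dom A" for y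
  proof -
    \<comment> \<open>The functional \<open>x \<mapsto> <AKx, y>\<close> is dominated by the norm of
      \<open>A x\<close>, so it is represented through \<open>A\<close>; the representing vector
      \<open>z\<close> solves \<open>A z = K* A y\<close>.\<close>
    have linf: "clinear_on (dom A) (\<lambda>x. cinner (L (K x)) y)"
      using lin dom_bound unfolding clinear_on_def
      by (simp add: K.add Ksc cinner_add_left cinner_scaleC_left scaleC_complex_def)
    have bd: "cmod (cinner (L (K x)) y) \<le> (onorm K * norm y) * norm (L x)" if x: "x \<in> dom A" for x
      using cmod_cinner_le[of "L (K x)" y] dom_bound[OF x]
        mult_right_mono[of "norm (L (K x))" "onorm K * norm (L x)" "norm y"]
      by (simp add: mult_ac)
    obtain z where z: "\<And>x. x \<in> dom A \<Longrightarrow> cinner (L (K x)) y = cinner (L x) z"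
      and nz: "norm z \<le> onorm K * norm y \<or> z = 0"
      using Riesz_representation_through[OF lin linf bd] by blast
    have "z \<in> dom A \<and> L z = Ks (L y)"
      by (rule A_memI) (use z sym y dom_bound Ks(1) in metis)
    moreover have "norm z \<le> onorm K * norm y" using nz Kpos by auto
    ultimately show ?thesis by blast
  qed
  \<comment> \<open>Formally \<open>z\<close> is \<open>A^-1 K* A K y\<close>. As \<open>A z\<close>
    fixes \<open>z\<close> only modulo the kernel of \<open>A\<close>, \<open>S\<close> is obtained
    by choice. One factor of the norm of \<open>K\<close> comes from the previous step, the other
    from \<open>K y\<close>.\<close>
  have "\<exists>z. z \<in> dom A \<and> L z = Ks (L (K y)) \<and> norm z \<le> (onorm K)\<^sup>2 * norm y" if y: "y \<in> dom A" for y
  proof -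
    obtain z where z: "z \<in> dom A" "L z = Ks (L (K y))" "norm z \<le> onorm K * norm (K y)"
      using step dom_bound[OF y] by blast
    have "onorm K * norm (K y) \<le> (onorm K)\<^sup>2 * norm y"
      using mult_left_mono[OF onorm[OF bl, of y] Kpos] by (simp add: power2_eq_square mult_ac)
    then show ?thesis using z by force
  qed
  then obtain S where S: "\<And>y. y \<in> dom A \<Longrightarrow> S y \<in> dom A"
    "\<And>y. y \<in> dom A \<Longrightarrow> L (S y) = Ks (L (K y))"
    "\<And>y. y \<in> dom A \<Longrightarrow> norm (S y) \<le> (onorm K)\<^sup>2 * norm y"
    by metis
  \<comment> \<open>The form of \<open>A S\<close> is the form of \<open>A\<close> pulled back along
    \<open>K\<close>, which makes it positive on \<open>dom A\<close>.\<close>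
  have LS: "cinner (L (S x)) y = cinner (L (K x)) (K y)" if "x \<in> dom A" for x y
    unfolding S(2)[OF that] using Ks(1)[of _ "L (K x)"] cinner_commute by metis
  have Ssym: "cinner (L (S x)) y = cinner (L x) (S y)" if x: "x \<in> dom A" and y: "y \<in> dom A" for x y
  proof -
    have "cinner (L (S x)) y = cinner (K x) (L (K y))"
      using LS[OF x] sym dom_bound x y by simp
    also have "\<dots> = cinner x (L (S y))" using Ks(1) S(2)[OF y] by simp
    also have "\<dots> = cinner (L x) (S y)" using sym S(1) x y by simp
    finally show ?thesis .
  qed
  have form: "Re (cinner (L (K x)) (K x)) \<le> (onorm K)\<^sup>2 * Re (cinner (L x) x)"
    if x: "x \<in> dom A" for x
  proof -
    have Spos: "0 \<le> Re (cinner (L (S y)) y)" if "y \<in> dom A" for y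
      using LS[OF that] pos dom_bound that by simp
    have "Re (cinner (L (S x)) x) \<le> (onorm K)\<^sup>2 * Re (cinner (L x) x)"
      by (rule symmetrizable_form_le[OF lin sym pos S(1) Ssym Spos S(3) _ x]) simp_all
    then show ?thesis using LS[OF x] by simp
  qed
  show ?thesis
  proof (intro ballI conjI)
    fix x assume x: "x \<in> dom A"
    then show "x \<in> dom (A \<circ> K)" using dom_bound Tdom T_def by auto
    define q where "q = Re (cinner (L x) x)"
    have q: "0 \<le> q" "cinner (L x) x = complex_of_real q"
      using posc[OF x] by (auto simp: q_def less_eq_complex_def complex_eq_iff)
    \<comment> \<open>Cauchy-Schwarz for the form of \<open>A\<close> at the pair
      \<open>K x\<close>, \<open>x\<close>; the bound on its value at \<open>K x\<close> then
      supplies the square of the norm of \<open>K\<close>.\<close>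
    have "(cmod (cinner (L (K x)) x))\<^sup>2 \<le> Re (cinner (L (K x)) (K x)) * q"
      unfolding q_def using Cauchy_Schwarz_form[OF lin sym pos] dom_bound x by blast
    also have "\<dots> \<le> ((onorm K)\<^sup>2 * q) * q"
      using form[OF x] q(1) by (intro mult_right_mono) (simp_all add: q_def)
    also have "\<dots> = (onorm K * q)\<^sup>2" by (simp add: power2_eq_square)
    finally have "cmod (cinner (L (K x)) x) \<le> onorm K * q"
      by (rule power2_le_imp_le) (use Kpos q in simp)
    then have "complex_of_real (cmod (cinner (L (K x)) x)) \<le> complex_of_real (onorm K) * cinner (L x) x"
      unfolding q(2) by (simp add: less_eq_complex_def)
    then show "complex_of_real (cmod (cinner (the ((A \<circ> K) x)) x))
        \<le> complex_of_real (onorm K) * cinner (the (A x)) x"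
      by (simp add: L_def)
  qed
qed

end
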